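(* There exists a constant $c>0$ such that any algorithm which, given sample access to an Ising model $p$ on $n$ nodes with no edges (i.e. a product measure on $\{\pm1\}^n$), distinguishes between the cases $p=\mathcal{U}_n$ and $d_{\mathrm{SKL}}(p,\mathcal{U}_n)\ge\varepsilon$ with probability at least $99/100$ requires $k\ge c\sqrt n/\varepsilon$ samples.
   Context: An Ising model on $n$ nodes is the distribution on $\{-1,1\}^n$ with $p(x)\propto\exp\big(\sum_{v}\theta_v x_v+\sum_{u\ne v}\theta_{uv}x_ux_v\big)$; having no edges means $\theta_{uv}=0$ for all $u\ne v$. $\mathcal{U}_n$ is the uniform distribution on $\{\pm1\}^n$. $d_{\mathrm{SKL}}(p,q)=d_{\mathrm{KL}}(p\|q)+d_{\mathrm{KL}}(q\|p)$. *)

theory Defs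
  imports "HOL-Probability.Probability"
begin

definition spin_configs :: "nat \<Rightarrow> (nat \<Rightarrow> real) set" where
  "spin_configs n = {..<n} \<rightarrow>\<^sub>E {-1, 1}"

text \<open>The interaction sum ranges over ordered pairs of distinct nodes; diagonal entries of
  \<open>J\<close> are never used.\<close>

definition ising_weight ::
    "nat \<Rightarrow> (nat \<Rightarrow> real) \<Rightarrow> (nat \<Rightarrow> nat \<Rightarrow> real) \<Rightarrow> (nat \<Rightarrow> real) \<Rightarrow> real" where
  "ising_weight n h J x =
     exp ((\<Sum>v<n. h v * x v) + (\<Sum>u<n. \<Sum>v\<in>{..<n} - {u}. J u v * x u * x v))"

definition ising_pmf :: "nat \<Rightarrow> (nat \<Rightarrow> real) \<Rightarrow> (nat \<Rightarrow> nat \<Rightarrow> real) \<Rightarrow> (nat \<Rightarrow> real) pmf" where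
  "ising_pmf n h J = embed_pmf (\<lambda>x. if x \<in> spin_configs n
     then ising_weight n h J x / (\<Sum>y\<in>spin_configs n. ising_weight n h J y) else 0)"

lemma finite_spin_configs [simp]: "finite (spin_configs n)"
  by (simp add: spin_configs_def finite_PiE)

lemma spin_configs_nonempty [simp]: "spin_configs n \<noteq> {}"
  by (simp add: spin_configs_def PiE_eq_empty_iff)

lemma pmf_ising_pmf:
  "pmf (ising_pmf n h J) x = (if x \<in> spin_configs n
     then ising_weight n h J x / (\<Sum>y\<in>spin_configs n. ising_weight n h J y) else 0)"
proof -
  let ?Z = "\<Sum>y\<in>spin_configs n. ising_weight n h J y"
  let ?f = "\<lambda>x. if x \<in> spin_configs n then ising_weight n h J x / ?Z else 0"
  have pos: "ising_weight n h J y > 0" for y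
    by (simp add: ising_weight_def)
  have Z: "?Z > 0"
    by (rule sum_pos) (auto simp: pos)
  have nonneg: "?f y \<ge> 0" for y
    using Z pos[of y] by simp
  have "(\<integral>\<^sup>+y. ennreal (?f y) \<partial>count_space UNIV) = (\<Sum>y\<in>spin_configs n. ennreal (?f y))"
    by (subst nn_integral_count_space'[of "spin_configs n"]) auto
  also have "\<dots> = ennreal (\<Sum>y\<in>spin_configs n. ?f y)"
    by (rule sum_ennreal) (rule nonneg)
  also have "(\<Sum>y\<in>spin_configs n. ?f y) = 1"
    using Z by (simp add: sum_divide_distrib[symmetric])
  finally have "(\<integral>\<^sup>+y. ennreal (?f y) \<partial>count_space UNIV) = 1"
    by simp
  then show ?thesis
    unfolding ising_pmf_def by (intro pmf_embed_pmf nonneg)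
qed

definition no_edges :: "nat \<Rightarrow> (nat \<Rightarrow> nat \<Rightarrow> real) \<Rightarrow> bool" where
  "no_edges n J \<longleftrightarrow> (\<forall>u<n. \<forall>v<n. u \<noteq> v \<longrightarrow> J u v = 0)"

definition uniform_spins :: "nat \<Rightarrow> (nat \<Rightarrow> real) pmf" where
  "uniform_spins n = pmf_of_set (spin_configs n)"

text \<open>\<open>KL_divergence b M N\<close> takes the reference measure first, that is, it is
  the divergence of \<open>N\<close> from \<open>M\<close> to base \<open>b\<close>; hence the swapped
  arguments.\<close>

definition d_KL :: "'a pmf \<Rightarrow> 'a pmf \<Rightarrow> real" where
  "d_KL p q = KL_divergence (exp 1) (measure_pmf q) (measure_pmf p)"

lemma d_KL_eq_sum:
  assumes A: "finite A" "set_pmf p = A" "set_pmf q = A"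
  shows "d_KL p q = (\<Sum>x\<in>A. pmf p x * ln (pmf p x / pmf q x))"
proof -
  let ?f = "\<lambda>x. pmf p x / pmf q x"
  have eq: "measure_pmf p = density (measure_pmf q) ?f"
  proof (rule measure_eqI)
    fix S
    have "emeasure (density (measure_pmf q) ?f) S = (\<integral>\<^sup>+x. ennreal (?f x) * indicator S x \<partial>measure_pmf q)"
      by (simp add: emeasure_density)
    also have "\<dots> = (\<Sum>x\<in>A. ennreal (?f x) * indicator S x * pmf q x)"
      using A by (subst nn_integral_measure_pmf_finite) auto
    also have "\<dots> = (\<Sum>x\<in>A. ennreal (pmf p x) * indicator S x)"
    proof (rule sum.cong[OF refl])
      fix x assume "x \<in> A"
      then have "pmf q x > 0" using A by (simp add: pmf_positive)
      then show "ennreal (?f x) * indicator S x * pmf q x = ennreal (pmf p x) * indicator S x"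
        by (auto simp: indicator_def ennreal_mult[symmetric])
    qed
    also have "\<dots> = (\<integral>\<^sup>+x. indicator S x \<partial>measure_pmf p)"
      using A by (subst nn_integral_measure_pmf_finite) (auto simp: mult.commute)
    finally show "emeasure (measure_pmf p) S = emeasure (density (measure_pmf q) ?f) S" by simp
  qed simp
  have "d_KL p q = (\<integral>x. ?f x * log (exp 1) (?f x) \<partial>measure_pmf q)"
    unfolding d_KL_def eq by (rule sigma_finite_measure.KL_density[OF measure_pmf.sigma_finite_measure_axioms]) auto
  also have "\<dots> = (\<Sum>x\<in>A. ?f x * log (exp 1) (?f x) * pmf q x)"
    using A by (subst integral_measure_pmf[of A]) (auto simp: mult_ac)
  also have "\<dots> = (\<Sum>x\<in>A. pmf p x * ln (pmf p x / pmf q x))"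
    using A by (intro sum.cong refl) (auto simp: log_def pmf_eq_0_set_pmf)
  finally show ?thesis .
qed

definition d_SKL :: "'a pmf \<Rightarrow> 'a pmf \<Rightarrow> real" where
  "d_SKL p q = d_KL p q + d_KL q p"

text \<open>A randomized algorithm using \<open>k\<close> samples is a map from the list of samples to a
  distribution over answers, where \<open>True\<close> stands for ``uniform''.
  A distribution on \<open>bool\<close> is just an acceptance probability, so no internal
  randomness is excluded.\<close>

definition run_tester :: "('a list \<Rightarrow> bool pmf) \<Rightarrow> nat \<Rightarrow> 'a pmf \<Rightarrow> bool pmf" where
  "run_tester T k p = bind_pmf (replicate_pmf k p) T"

definition distinguishes_uniform ::
    "nat \<Rightarrow> real \<Rightarrow> nat \<Rightarrow> ((nat \<Rightarrow> real) list \<Rightarrow> bool pmf) \<Rightarrow> bool" where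
  "distinguishes_uniform n \<epsilon> k T \<longleftrightarrow>
     (\<forall>h J. no_edges n J \<longrightarrow>
        (ising_pmf n h J = uniform_spins n \<longrightarrow>
           pmf (run_tester T k (ising_pmf n h J)) True \<ge> 99 / 100) \<and>
        (d_SKL (ising_pmf n h J) (uniform_spins n) \<ge> \<epsilon> \<longrightarrow>
           pmf (run_tester T k (ising_pmf n h J)) False \<ge> 99 / 100))"

end

theory Submission
  imports Defs
begin

text \<open>Take all external fields equal to \<open>h\<close> in absolute value, with uniformly random signs, where
  \<open>h tanh h = \<epsilon> / n\<close>; every such Ising model is at symmetric divergence exactly \<open>\<epsilon>\<close>.
  Averaged over the signs, the likelihood ratio of \<open>k\<close> samples has second moment
  \<open>(((1 + y) ^ k + (1 - y) ^ k) / 2) ^ n \<le> exp (n (k y)\<^sup>2 / 2)\<close> with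
  \<open>y = (tanh h)\<^sup>2 \<le> \<epsilon> / n\<close>. A tester with error \<open>1 / 100\<close> forces it to be at least
  \<open>1 + (98 / 100)\<^sup>2 > exp (1 / 2)\<close>, so \<open>k \<epsilon> \<ge> sqrt n\<close>.\<close>

section \<open>Expectations over lists of independent samples\<close>

text \<open>\<open>A\<close> may exceed the support, so that one index set serves two distributions
  in the change of measure.\<close>

lemma replicate_pmf_expectation_Suc:
  fixes F :: "'a list \<Rightarrow> real"
  assumes "finite A" "set_pmf p \<subseteq> A"
  shows "measure_pmf.expectation (replicate_pmf (Suc k) p) F =
    (\<Sum>x\<in>A. pmf p x * measure_pmf.expectation (replicate_pmf k p) (\<lambda>xs. F (x # xs)))"
proof -
  have fin: "finite (set_pmf (replicate_pmf k p))"
    using finite_subset[OF assms(2,1)] by (auto simp: set_replicate_pmf lists_eq_set finite_lists_length_eq)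
  have "replicate_pmf (Suc k) p = p \<bind> (\<lambda>x. map_pmf ((#) x) (replicate_pmf k p))"
    by (simp add: map_pmf_def)
  then show ?thesis
    using assms fin by (simp add: pmf_expectation_bind del: replicate_pmf.simps)
qed

text \<open>Likelihood ratios of independent samples multiply. The relation between \<open>p\<close>
  and \<open>q\<close> forces the support of \<open>p\<close> into that of \<open>q\<close>, so both
  expectations unfold over \<open>set_pmf q\<close>.\<close>

lemma replicate_pmf_change_of_measure:
  fixes F :: "'a list \<Rightarrow> real"
  assumes "finite (set_pmf q)" "\<And>x. pmf p x = pmf q x * g x"
  shows "measure_pmf.expectation (replicate_pmf k p) F =
    measure_pmf.expectation (replicate_pmf k q) (\<lambda>xs. prod_list (map g xs) * F xs)"
proof (induction k arbitrary: F)
  case 0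
  then show ?case by simp
next
  case (Suc k)
  have sub: "set_pmf p \<subseteq> set_pmf q"
    using assms(2) by (auto simp: set_pmf_iff)
  show ?case
    unfolding replicate_pmf_expectation_Suc[OF assms(1) sub]
      replicate_pmf_expectation_Suc[OF assms(1) subset_refl] Suc.IH
    by (simp add: assms(2) mult.assoc del: replicate_pmf.simps)
qed

lemma replicate_pmf_expectation_prod_list:
  fixes g :: "'a \<Rightarrow> real"
  assumes "finite (set_pmf q)"
  shows "measure_pmf.expectation (replicate_pmf k q) (\<lambda>xs. prod_list (map g xs)) =
    measure_pmf.expectation q g ^ k"
proof (induction k)
  case 0
  then show ?case by simp
next
  case (Suc k)
  show ?case
    unfolding replicate_pmf_expectation_Suc[OF assms subset_refl]
    using assms by (simp add: Suc.IH integral_measure_pmf_real[of "set_pmf q"] sum_distrib_right mult_ac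
        del: replicate_pmf.simps)
qed

lemma pmf_run_tester:
  "pmf (run_tester T k p) b = measure_pmf.expectation (replicate_pmf k p) (\<lambda>xs. pmf (T xs) b)"
  by (simp add: run_tester_def pmf_bind)

section \<open>Second-moment bound for mixtures\<close>

lemma (in prob_space) expectation_power2_le:
  fixes X :: "'a \<Rightarrow> real"
  assumes "integrable M X" "integrable M (\<lambda>x. (X x)\<^sup>2)"
  shows "(expectation X)\<^sup>2 \<le> expectation (\<lambda>x. (X x)\<^sup>2)"
  using variance_positive[of X] variance_eq[OF assms] by simp

text \<open>Writing \<open>L\<close> for the likelihood ratio of the mixture, the tester's advantage is
  \<open>E F (1 - L)\<close>, at most the root of \<open>E (1 - L)\<^sup>2 = E L\<^sup>2 - 1\<close>; expanding \<open>L\<^sup>2\<close> and using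
  independence of the samples gives the double sum.\<close>

lemma mixture_second_moment_ge:
  fixes F :: "'a list \<Rightarrow> real" and g :: "'s \<Rightarrow> 'a \<Rightarrow> real"
  assumes S: "finite S" "S \<noteq> {}" and q: "finite (set_pmf q)"
    and g: "\<And>s x. s \<in> S \<Longrightarrow> pmf (p s) x = pmf q x * g s x"
    and F: "\<And>xs. 0 \<le> F xs" "\<And>xs. F xs \<le> 1" and "0 \<le> d"
    and adv: "\<And>s. s \<in> S \<Longrightarrow>
      measure_pmf.expectation (replicate_pmf k (p s)) F + d
        \<le> measure_pmf.expectation (replicate_pmf k q) F"
  shows "1 + d\<^sup>2 \<le> (\<Sum>s\<in>S. \<Sum>t\<in>S. measure_pmf.expectation q (\<lambda>x. g s x * g t x) ^ k) / (real (card S))\<^sup>2"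
proof -
  let ?E = "measure_pmf.expectation (replicate_pmf k q)"
  define G where "G s xs = prod_list (map (g s) xs)" for s xs
  define L where "L xs = (\<Sum>s\<in>S. G s xs) / card S" for xs
  have cS: "real (card S) > 0"
    using S by (simp add: card_gt_0_iff)
  have fin: "finite (set_pmf (replicate_pmf k q))"
    using q by (auto simp: set_replicate_pmf lists_eq_set finite_lists_length_eq)
  have int [simp]: "integrable (replicate_pmf k q) X" for X :: "'a list \<Rightarrow> real"
    by (rule integrable_measure_pmf_finite[OF fin])
  have com: "measure_pmf.expectation (replicate_pmf k (p s)) X = ?E (\<lambda>xs. G s xs * X xs)" if "s \<in> S" for s X
    unfolding G_def by (rule replicate_pmf_change_of_measure[OF q g[OF that]])
  have EL: "?E (\<lambda>xs. L xs * X xs) = (\<Sum>s\<in>S. measure_pmf.expectation (replicate_pmf k (p s)) X) / card S" for X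
    by (simp add: L_def sum_divide_distrib sum_distrib_right com)
  have EG: "?E (\<lambda>xs. G s xs * G t xs) = measure_pmf.expectation q (\<lambda>x. g s x * g t x) ^ k" for s t
  proof -
    have "G s xs * G t xs = prod_list (map (\<lambda>x. g s x * g t x) xs)" for xs
      by (induction xs) (simp_all add: G_def mult_ac)
    then show ?thesis
      by (simp add: replicate_pmf_expectation_prod_list[OF q])
  qed
  have "?E L = 1"
    using EL[of "\<lambda>_. 1"] cS by simp
  have "(\<Sum>s\<in>S. measure_pmf.expectation (replicate_pmf k (p s)) F) \<le> (\<Sum>s\<in>S. ?E F - d)"
    using adv by (intro sum_mono) (simp add: le_diff_eq)
  then have "?E (\<lambda>xs. L xs * F xs) \<le> ?E F - d"
    unfolding EL using cS by (simp add: divide_le_eq mult.commute)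
  then have "d \<le> ?E (\<lambda>xs. F xs * (1 - L xs))"
    by (simp add: algebra_simps)
  then have "d\<^sup>2 \<le> (?E (\<lambda>xs. F xs * (1 - L xs)))\<^sup>2"
    using \<open>0 \<le> d\<close> by (rule power_mono)
  also have "\<dots> \<le> ?E (\<lambda>xs. (F xs * (1 - L xs))\<^sup>2)"
    by (rule measure_pmf.expectation_power2_le) simp_all
  also have "\<dots> \<le> ?E (\<lambda>xs. (1 - L xs)\<^sup>2)"
  proof (rule integral_mono)
    fix xs
    have "(F xs)\<^sup>2 \<le> 1"
      using F[of xs] by (simp add: power_le_one)
    then show "(F xs * (1 - L xs))\<^sup>2 \<le> (1 - L xs)\<^sup>2"
      by (simp add: power_mult_distrib mult_left_le_one_le)
  qed simp_all
  also have "\<dots> = ?E (\<lambda>xs. (L xs)\<^sup>2) - 1"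
    using \<open>?E L = 1\<close> by (simp add: power2_diff)
  also have "(\<lambda>xs. (L xs)\<^sup>2) = (\<lambda>xs. (\<Sum>s\<in>S. \<Sum>t\<in>S. G s xs * G t xs) / (card S)\<^sup>2)"
    by (simp add: L_def power_divide sum_product power2_eq_square)
  also have "?E \<dots> = (\<Sum>s\<in>S. \<Sum>t\<in>S. ?E (\<lambda>xs. G s xs * G t xs)) / (card S)\<^sup>2"
    by simp
  finally show ?thesis by (simp add: EG)
qed

section \<open>Uniform spins and factorizing sums\<close>

lemma card_spin_configs: "card (spin_configs n) = 2 ^ n"
  by (simp add: spin_configs_def card_PiE numeral_2_eq_2)

lemma set_uniform_spins [simp]: "set_pmf (uniform_spins n) = spin_configs n"
  by (simp add: uniform_spins_def)

lemma pmf_uniform_spins: "pmf (uniform_spins n) x = (if x \<in> spin_configs n then 1 / 2 ^ n else 0)"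
  by (simp add: uniform_spins_def card_spin_configs)

lemma expectation_uniform_spins:
  fixes F :: "(nat \<Rightarrow> real) \<Rightarrow> real"
  shows "measure_pmf.expectation (uniform_spins n) F = (\<Sum>x\<in>spin_configs n. F x) / 2 ^ n"
  by (simp add: uniform_spins_def integral_pmf_of_set card_spin_configs)

text \<open>Distributivity over the product set, that is, independence of uniform spins. The sums
  over configurations below are evaluated by choosing \<open>f\<close>.\<close>

lemma sum_prod_spin_configs:
  fixes f :: "nat \<Rightarrow> real \<Rightarrow> real"
  shows "(\<Sum>x\<in>spin_configs n. \<Prod>v<n. f v (x v)) = (\<Prod>v<n. f v 1 + f v (-1))"
  unfolding spin_configs_def
  by (subst prod_sum_PiE[symmetric]) (auto simp: add.commute)

lemma expectation_uniform_spins_prod: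
  fixes f :: "nat \<Rightarrow> real \<Rightarrow> real"
  shows "measure_pmf.expectation (uniform_spins n) (\<lambda>x. \<Prod>v<n. f v (x v)) =
    (\<Prod>v<n. (f v 1 + f v (-1)) / 2)"
  by (simp add: expectation_uniform_spins sum_prod_spin_configs prod_dividef)

lemma spin_configs_cases:
  assumes "x \<in> spin_configs n" "v < n"
  obtains "x v = 1" | "x v = -1"
  using assms by (auto simp: spin_configs_def PiE_iff)

section \<open>Edge-free Ising models as densities\<close>

text \<open>On a sign, \<open>exp (h * s) = cosh h + s * sinh h\<close>; pulling out
  \<open>cosh h\<close> leaves a factor affine in \<open>s\<close>.\<close>

lemma exp_spin:
  fixes h s :: real
  assumes "s = 1 \<or> s = -1"
  shows "exp (h * s) = cosh h * (1 + tanh h * s)"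
  using assms cosh_real_pos[of h]
  by (auto simp: tanh_def field_simps simp flip: sinh_plus_cosh)

text \<open>The density of the edge-free model with fields \<open>h\<close> relative to
  \<open>uniform_spins n\<close>; the \<open>cosh\<close> factors of the weight cancel against the
  normalization.\<close>

definition ising_ratio :: "nat \<Rightarrow> (nat \<Rightarrow> real) \<Rightarrow> (nat \<Rightarrow> real) \<Rightarrow> real" where
  "ising_ratio n h x = (\<Prod>v<n. 1 + tanh (h v) * x v)"

lemma ising_weight_no_edges:
  assumes "no_edges n J" "x \<in> spin_configs n"
  shows "ising_weight n h J x = (\<Prod>v<n. cosh (h v)) * ising_ratio n h x"
proof -
  have "(\<Sum>u<n. \<Sum>v\<in>{..<n} - {u}. J u v * x u * x v) = 0"
    using assms(1) by (intro sum.neutral ballI) (auto simp: no_edges_def)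
  then have "ising_weight n h J x = (\<Prod>v<n. exp (h v * x v))"
    by (simp add: ising_weight_def exp_sum)
  also have "\<dots> = (\<Prod>v<n. cosh (h v) * (1 + tanh (h v) * x v))"
    using assms(2) by (intro prod.cong refl exp_spin) (auto elim: spin_configs_cases)
  finally show ?thesis
    by (simp add: ising_ratio_def prod.distrib)
qed

lemma sum_ising_ratio: "(\<Sum>x\<in>spin_configs n. ising_ratio n h x) = 2 ^ n"
  using sum_prod_spin_configs[of "\<lambda>v s. 1 + tanh (h v) * s" n]
  by (simp add: ising_ratio_def)

lemma pmf_ising_no_edges:
  assumes "no_edges n J"
  shows "pmf (ising_pmf n h J) x = pmf (uniform_spins n) x * ising_ratio n h x"
proof -
  have "(\<Sum>y\<in>spin_configs n. ising_weight n h J y) = (\<Prod>v<n. cosh (h v)) * 2 ^ n"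
    using ising_weight_no_edges[OF assms]
    by (simp add: sum_distrib_left[symmetric] sum_ising_ratio)
  moreover have "(\<Prod>v<n. cosh (h v)) > 0"
    by (intro prod_pos) auto
  ultimately show ?thesis
    by (simp add: pmf_ising_pmf pmf_uniform_spins ising_weight_no_edges[OF assms])
qed

lemma ising_ratio_pos:
  assumes "x \<in> spin_configs n"
  shows "ising_ratio n h x > 0"
  unfolding ising_ratio_def
proof (intro prod_pos ballI)
  fix v assume "v \<in> {..<n}"
  then show "1 + tanh (h v) * x v > 0"
    using tanh_real_lt_1[of "h v"] tanh_real_gt_neg1[of "h v"]
    by (auto elim!: spin_configs_cases[OF assms, of v])
qed

section \<open>Symmetric divergence from uniform\<close>

text \<open>With zero interactions the weight is the exponential of the field term, so its
  factorization can be solved for the ratio. The logarithm is affine in the spins, hence first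
  moments determine the divergence.\<close>

lemma ln_ising_ratio:
  assumes "x \<in> spin_configs n"
  shows "ln (ising_ratio n h x) = (\<Sum>v<n. h v * x v) - (\<Sum>v<n. ln (cosh (h v)))"
proof -
  have pos: "(\<Prod>v<n. cosh (h v)) > 0"
    by (intro prod_pos) auto
  have "exp (\<Sum>v<n. h v * x v) = (\<Prod>v<n. cosh (h v)) * ising_ratio n h x"
    using ising_weight_no_edges[of n "\<lambda>_ _. 0" x h] assms
    by (simp add: ising_weight_def no_edges_def)
  then have "(\<Sum>v<n. h v * x v) = ln ((\<Prod>v<n. cosh (h v)) * ising_ratio n h x)"
    by (metis ln_exp)
  also have "\<dots> = ln (\<Prod>v<n. cosh (h v)) + ln (ising_ratio n h x)"
    using pos ising_ratio_pos[OF assms, of h] by (simp add: ln_mult_pos)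
  also have "ln (\<Prod>v<n. cosh (h v)) = (\<Sum>v<n. ln (cosh (h v)))"
    by (rule ln_prod) auto
  finally show ?thesis by simp
qed

lemma sum_spin_configs_coordinate:
  assumes "v < n"
  shows "(\<Sum>x\<in>spin_configs n. x v) = 0"
proof -
  \<comment> \<open>Padding with trivial factors brings a single coordinate into product
    form.\<close>
  have "x v = (\<Prod>w<n. if w = v then x w else 1)" for x :: "nat \<Rightarrow> real"
    using assms by (simp add: prod.delta)
  then have "(\<Sum>x\<in>spin_configs n. x v) =
      (\<Sum>x\<in>spin_configs n. \<Prod>w<n. (\<lambda>w s. if w = v then s else 1) w (x w))"
    by simp
  also have "\<dots> = 0"
    unfolding sum_prod_spin_configs[of "\<lambda>w s. if w = v then s else 1"]
    using assms by (intro prod_zero bexI[of _ v]) auto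
  finally show ?thesis .
qed

text \<open>Up to the factor \<open>2 ^ n\<close>, this is the mean of spin \<open>v\<close> under
  the model: factor \<open>v\<close> sums to \<open>(1 + t) - (1 - t)\<close> with
  \<open>t = tanh (h v)\<close>, every other factor to \<open>2\<close>.\<close>

lemma sum_ising_ratio_coordinate:
  assumes "v < n"
  shows "(\<Sum>x\<in>spin_configs n. ising_ratio n h x * x v) = 2 ^ n * tanh (h v)"
proof -
  let ?f = "\<lambda>w s. (1 + tanh (h w) * s) * (if w = v then s else 1)"
  have "x v = (\<Prod>w<n. if w = v then x w else 1)" for x :: "nat \<Rightarrow> real"
    using assms by (simp add: prod.delta)
  then have "(\<Sum>x\<in>spin_configs n. ising_ratio n h x * x v) =
      (\<Sum>x\<in>spin_configs n. \<Prod>w<n. ?f w (x w))"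
    unfolding ising_ratio_def prod.distrib by simp
  also have "\<dots> = (\<Prod>w<n. 2 * (if w = v then tanh (h w) else 1))"
    unfolding sum_prod_spin_configs[of ?f] by (intro prod.cong) auto
  also have "\<dots> = 2 ^ n * tanh (h v)"
    using assms by (simp add: prod.distrib prod.delta)
  finally show ?thesis .
qed

text \<open>The two divergences combine to the uniform average of \<open>(r - 1) * ln r\<close>,
  with \<open>r\<close> the ratio. The constant part of \<open>ln r\<close> drops out because
  \<open>r\<close> averages to \<open>1\<close>; the linear part sees only the difference of the
  means \<open>tanh (h v)\<close> and \<open>0\<close>.\<close>

lemma d_SKL_ising_no_edges:
  assumes "no_edges n J"
  shows "d_SKL (ising_pmf n h J) (uniform_spins n) = (\<Sum>v<n. h v * tanh (h v))"
proof -
  let ?S = "spin_configs n" and ?r = "ising_ratio n h"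
  have set: "set_pmf (ising_pmf n h J) = ?S"
    using ising_ratio_pos[of _ n h]
    by (auto simp: set_pmf_iff pmf_ising_no_edges[OF assms] pmf_uniform_spins split: if_splits)
       (metis less_irrefl)
  have "d_SKL (ising_pmf n h J) (uniform_spins n) = (\<Sum>x\<in>?S. (?r x - 1) * ln (?r x) / 2 ^ n)"
    unfolding d_SKL_def d_KL_eq_sum[OF finite_spin_configs set set_uniform_spins]
      d_KL_eq_sum[OF finite_spin_configs set_uniform_spins set] sum.distrib[symmetric]
  proof (rule sum.cong[OF refl])
    fix x assume x: "x \<in> ?S"
    show "pmf (ising_pmf n h J) x * ln (pmf (ising_pmf n h J) x / pmf (uniform_spins n) x) +
        pmf (uniform_spins n) x * ln (pmf (uniform_spins n) x / pmf (ising_pmf n h J) x) =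
        (?r x - 1) * ln (?r x) / 2 ^ n"
      using x ising_ratio_pos[OF x, of h]
      by (simp add: pmf_ising_no_edges[OF assms] pmf_uniform_spins ln_div field_simps)
  qed
  also have "\<dots> = (\<Sum>x\<in>?S. (?r x - 1) * ((\<Sum>v<n. h v * x v) - (\<Sum>v<n. ln (cosh (h v))))) / 2 ^ n"
    by (simp add: sum_divide_distrib ln_ising_ratio)
  also have "(\<Sum>x\<in>?S. (?r x - 1) * ((\<Sum>v<n. h v * x v) - (\<Sum>v<n. ln (cosh (h v))))) =
      (\<Sum>x\<in>?S. \<Sum>v<n. h v * (?r x * x v - x v)) - (\<Sum>x\<in>?S. ?r x - 1) * (\<Sum>v<n. ln (cosh (h v)))"
  proof -
    have "(?r x - 1) * ((\<Sum>v<n. h v * x v) - C) = (\<Sum>v<n. h v * (?r x * x v - x v)) - (?r x - 1) * C" for x C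
      by (simp add: sum_distrib_left right_diff_distrib sum_subtractf algebra_simps)
    then show ?thesis
      by (simp only: sum_distrib_right) (rule sum_subtractf)
  qed
  also have "(\<Sum>x\<in>?S. ?r x - 1) = 0"
    by (simp add: sum_subtractf sum_ising_ratio card_spin_configs)
  also have "(\<Sum>x\<in>?S. \<Sum>v<n. h v * (?r x * x v - x v)) = (\<Sum>v<n. h v * (2 ^ n * tanh (h v)))"
    by (subst sum.swap) (simp add: sum_distrib_left[symmetric] sum_subtractf
        sum_ising_ratio_coordinate sum_spin_configs_coordinate)
  finally show ?thesis
    by (simp add: sum_divide_distrib)
qed

section \<open>Hyperbolic functions\<close>

text \<open>Hoeffding's lemma for a fair sign: \<open>ln (cosh x)\<close> is the function in
  \<open>Hoeffdings_lemma_aux\<close> at width \<open>2 * x\<close> and weight \<open>1 / 2\<close>,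
  and the bound \<open>(2 * x)\<^sup>2 / 8\<close> is the exponent here.\<close>

lemma cosh_le_exp_power2:
  fixes x :: real
  assumes "0 \<le> x"
  shows "cosh x \<le> exp (x\<^sup>2 / 2)"
proof -
  have "cosh x = exp (- x) * (1 + 1 / 2 * (exp (2 * x) - 1))"
    by (simp add: cosh_def algebra_simps exp_add[symmetric])
  moreover have "1 + 1 / 2 * (exp (2 * x) - 1) > 0"
    using exp_gt_zero[of "2 * x"] by argo
  ultimately have "ln (cosh x) = - x + ln (1 + 1 / 2 * (exp (2 * x) - 1))"
    by (simp add: ln_mult_pos)
  also have "\<dots> \<le> x\<^sup>2 / 2"
    using Hoeffdings_lemma_aux[of "2 * x" "1 / 2"] assms by (simp add: power_mult_distrib)
  finally show ?thesis
    by (metis cosh_real_pos exp_le_cancel_iff exp_ln)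
qed

lemma sinh_le_mult_cosh:
  fixes x :: real
  assumes "0 \<le> x"
  shows "sinh x \<le> x * cosh x"
proof -
  have "(\<lambda>x::real. x * cosh x - sinh x) 0 \<le> (\<lambda>x. x * cosh x - sinh x) x"
    using assms
  proof (rule DERIV_nonneg_imp_nondecreasing)
    fix y :: real assume "0 \<le> y"
    then show "\<exists>D. ((\<lambda>x. x * cosh x - sinh x) has_real_derivative D) (at y) \<and> D \<ge> 0"
      by (intro exI[of _ "y * sinh y"]) (auto intro!: derivative_eq_intros)
  qed
  then show ?thesis by simp
qed

lemma tanh_le_self:
  fixes x :: real
  assumes "0 \<le> x"
  shows "tanh x \<le> x"
  using sinh_le_mult_cosh[OF assms] by (simp add: tanh_def divide_le_eq)

lemma exists_mult_tanh_eq: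
  fixes a :: real
  assumes "0 \<le> a"
  shows "\<exists>h\<ge>0. h * tanh h = a"
proof -
  \<comment> \<open>Chosen so that \<open>b \<ge> 1\<close> and
    \<open>b * tanh 1 = tanh 1 + a\<close>; monotonicity of \<open>tanh\<close> then makes
    \<open>b\<close> an upper endpoint for the intermediate value theorem.\<close>
  define b where "b = 1 + a / tanh (1::real)"
  have t1: "tanh (1::real) > 0" by simp
  have b: "1 \<le> b" using assms t1 by (simp add: b_def)
  have "a \<le> b * tanh 1"
    using t1 by (simp add: b_def field_simps)
  also have "\<dots> \<le> b * tanh b"
    using b by (intro mult_left_mono) auto
  finally have "a \<le> b * tanh b" .
  then show ?thesis
    using IVT'[of "\<lambda>h. h * tanh h" 0 a b] assms b by (fastforce intro: continuous_intros)
qed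

section \<open>Second moment of the random-sign mixture\<close>

text \<open>In each coordinate the terms linear in the spin average out, and the squared spin is
  \<open>1\<close>.\<close>

lemma expectation_ising_ratio_mult:
  "measure_pmf.expectation (uniform_spins n) (\<lambda>x. ising_ratio n h x * ising_ratio n h' x) =
    (\<Prod>v<n. 1 + tanh (h v) * tanh (h' v))"
  using expectation_uniform_spins_prod[of n "\<lambda>v s. (1 + tanh (h v) * s) * (1 + tanh (h' v) * s)"]
  by (simp add: ising_ratio_def prod.distrib[symmetric] algebra_simps add_divide_distrib)

text \<open>From \<open>1 + y \<le> exp y\<close> and \<open>1 - y \<le> exp (- y)\<close> the
  average is at most \<open>cosh (k * y)\<close>. The bound \<open>y \<le> 1\<close> keeps
  \<open>1 - y\<close> nonnegative, so that powers preserve the order.\<close>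

lemma average_power_le_exp:
  fixes y :: real
  assumes "0 \<le> y" "y \<le> 1"
  shows "((1 + y) ^ k + (1 - y) ^ k) / 2 \<le> exp ((real k * y)\<^sup>2 / 2)"
proof -
  have "(1 + y) ^ k \<le> exp y ^ k" "(1 - y) ^ k \<le> exp (- y) ^ k"
    using assms exp_ge_add_one_self[of y] exp_ge_add_one_self[of "- y"]
    by (auto intro!: power_mono)
  then have "((1 + y) ^ k + (1 - y) ^ k) / 2 \<le> cosh (real k * y)"
    by (simp add: cosh_def exp_of_nat_mult[symmetric])
  also have "\<dots> \<le> exp ((real k * y)\<^sup>2 / 2)"
    using assms by (intro cosh_le_exp_power2) simp
  finally show ?thesis .
qed

lemma sum_prod_sign_power_le:
  fixes y :: real
  assumes "0 \<le> y" "y \<le> 1" "\<sigma> \<in> spin_configs n"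
  shows "(\<Sum>\<tau>\<in>spin_configs n. (\<Prod>v<n. 1 + \<sigma> v * \<tau> v * y) ^ k)
    \<le> 2 ^ n * exp (real n * (real k * y)\<^sup>2 / 2)"
proof -
  have "(\<Sum>\<tau>\<in>spin_configs n. (\<Prod>v<n. 1 + \<sigma> v * \<tau> v * y) ^ k)
      = (\<Prod>v<n. (1 + \<sigma> v * y) ^ k + (1 - \<sigma> v * y) ^ k)"
    using sum_prod_spin_configs[of "\<lambda>v s. (1 + \<sigma> v * s * y) ^ k" n]
    by (simp add: prod_power_distrib)
  \<comment> \<open>Flipping \<open>\<sigma> v\<close> only swaps the two summands, so the value is
    the same for every \<open>\<sigma>\<close>.\<close>
  also have "\<dots> = (\<Prod>v<n. 2 * (((1 + y) ^ k + (1 - y) ^ k) / 2))"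
    by (intro prod.cong refl) (auto elim: spin_configs_cases[OF assms(3)])
  also have "\<dots> = 2 ^ n * (((1 + y) ^ k + (1 - y) ^ k) / 2) ^ n"
    unfolding prod.distrib by simp
  also have "\<dots> \<le> 2 ^ n * exp ((real k * y)\<^sup>2 / 2) ^ n"
    using assms average_power_le_exp[of y k] by (intro mult_left_mono power_mono) auto
  finally show ?thesis
    by (simp add: exp_of_nat_mult[symmetric])
qed

section \<open>The sample lower bound\<close>

lemma ising_pmf_zero:
  assumes "no_edges n J"
  shows "ising_pmf n (\<lambda>_. 0) J = uniform_spins n"
  by (rule pmf_eqI) (simp add: pmf_ising_no_edges[OF assms] ising_ratio_def)

text \<open>After squaring, \<open>exp 1 \<le> 3\<close> suffices, since the right side squares to
  more than \<open>3.8\<close>.\<close>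

lemma exp_half_less: "exp (1 / 2 :: real) < 1 + (98 / 100)\<^sup>2"
proof (rule power2_less_imp_less)
  show "(exp (1 / 2 :: real))\<^sup>2 < (1 + (98 / 100)\<^sup>2)\<^sup>2"
    using exp_le by (simp add: power2_eq_square exp_add[symmetric])
qed simp

lemma distinguishes_uniform_sample_bound:
  assumes "n \<ge> 1" "\<epsilon> > 0" and dist: "distinguishes_uniform n \<epsilon> k T"
  shows "sqrt (real n) \<le> real k * \<epsilon>"
proof (rule ccontr)
  assume "\<not> sqrt (real n) \<le> real k * \<epsilon>"
  then have "(real k * \<epsilon>)\<^sup>2 \<le> real n"
    using assms(2) power_mono[of "real k * \<epsilon>" "sqrt (real n)" 2] by simp
  define J :: "nat \<Rightarrow> nat \<Rightarrow> real" where "J = (\<lambda>_ _. 0)"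
  have J: "no_edges n J" by (simp add: J_def no_edges_def)
  \<comment> \<open>Each of the \<open>n\<close> coordinates is to contribute
    \<open>\<epsilon> / n\<close> to the divergence; \<open>x * tanh x\<close> is even, so the signs
    do not change this.\<close>
  obtain h where h: "h \<ge> 0" "h * tanh h = \<epsilon> / n"
    using exists_mult_tanh_eq[of "\<epsilon> / n"] assms by auto
  define y where "y = (tanh h)\<^sup>2"
  have "tanh h \<ge> 0" "tanh h \<le> h" "tanh h < 1"
    using h(1) tanh_le_self tanh_real_lt_1 by auto
  then have y: "0 \<le> y" "y \<le> 1" "y \<le> \<epsilon> / n"
    using mult_right_mono[of "tanh h" h "tanh h"] h power_le_one[of "tanh h" 2]
    by (simp_all add: y_def power2_eq_square)
  let ?S = "spin_configs n" and ?h = "\<lambda>\<sigma> v. h * \<sigma> v :: real"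
  have tanh_sign: "tanh (h * \<sigma> v) = \<sigma> v * tanh h" "\<sigma> v * \<sigma> v = 1" if "\<sigma> \<in> ?S" "v < n" for \<sigma> v
    by (rule spin_configs_cases[OF that]; simp)+
  have accept: "pmf (run_tester T k (uniform_spins n)) True \<ge> 99 / 100"
    using dist J ising_pmf_zero[OF J] by (metis distinguishes_uniform_def)
  have reject: "pmf (run_tester T k (ising_pmf n (?h \<sigma>) J)) True \<le> 1 / 100" if \<sigma>: "\<sigma> \<in> ?S" for \<sigma>
  proof -
    have "h * \<sigma> v * tanh (h * \<sigma> v) = \<epsilon> / n" if "v < n" for v
      using tanh_sign[OF \<sigma> that] h(2) by (simp add: algebra_simps)
    then have "d_SKL (ising_pmf n (?h \<sigma>) J) (uniform_spins n) = \<epsilon>"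
      using assms(1) by (simp add: d_SKL_ising_no_edges[OF J])
    then have "pmf (run_tester T k (ising_pmf n (?h \<sigma>) J)) False \<ge> 99 / 100"
      using dist J by (simp add: distinguishes_uniform_def)
    then show ?thesis
      by (simp add: pmf_False_conv_True)
  qed
  \<comment> \<open>The advantage is the gap between acceptance at least \<open>99 / 100\<close>
    under uniform and at most \<open>1 / 100\<close> under each signed model.\<close>
  have "1 + (98 / 100)\<^sup>2 \<le> (\<Sum>\<sigma>\<in>?S. \<Sum>\<tau>\<in>?S. measure_pmf.expectation (uniform_spins n)
      (\<lambda>x. ising_ratio n (?h \<sigma>) x * ising_ratio n (?h \<tau>) x) ^ k) / (real (card ?S))\<^sup>2"
  proof (rule mixture_second_moment_ge)
    show "pmf (ising_pmf n (?h \<sigma>) J) x = pmf (uniform_spins n) x * ising_ratio n (?h \<sigma>) x" for \<sigma> x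
      by (rule pmf_ising_no_edges[OF J])
    show "measure_pmf.expectation (replicate_pmf k (ising_pmf n (?h \<sigma>) J)) (\<lambda>xs. pmf (T xs) True) + 98 / 100
        \<le> measure_pmf.expectation (replicate_pmf k (uniform_spins n)) (\<lambda>xs. pmf (T xs) True)" if "\<sigma> \<in> ?S" for \<sigma>
      using accept reject[OF that] by (simp add: pmf_run_tester)
  qed (auto simp: pmf_le_1)
  also have "(\<Sum>\<sigma>\<in>?S. \<Sum>\<tau>\<in>?S. measure_pmf.expectation (uniform_spins n)
      (\<lambda>x. ising_ratio n (?h \<sigma>) x * ising_ratio n (?h \<tau>) x) ^ k) =
      (\<Sum>\<sigma>\<in>?S. \<Sum>\<tau>\<in>?S. (\<Prod>v<n. 1 + \<sigma> v * \<tau> v * y) ^ k)"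
    unfolding expectation_ising_ratio_mult
    by (intro sum.cong refl arg_cong[where f="\<lambda>x. x ^ k"] prod.cong)
       (auto simp: tanh_sign y_def power2_eq_square)
  \<comment> \<open>The inner sum is bounded for each fixed \<open>\<sigma>\<close>; its
    \<open>2 ^ n\<close> and the \<open>2 ^ n\<close> choices of \<open>\<sigma>\<close> cancel the
    squared cardinality.\<close>
  also have "\<dots> \<le> (\<Sum>\<sigma>\<in>?S. 2 ^ n * exp (real n * (real k * y)\<^sup>2 / 2))"
    by (intro sum_mono sum_prod_sign_power_le y)
  finally have "1 + (98 / 100)\<^sup>2 \<le> exp (real n * (real k * y)\<^sup>2 / 2)"
    by (simp add: card_spin_configs power2_eq_square divide_right_mono)
  \<comment> \<open>By \<open>y \<le> \<epsilon> / n\<close>, the left side is at most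
    \<open>(k * \<epsilon>)\<^sup>2 / (2 * n)\<close>, where the negated claim applies.\<close>
  also have "real n * (real k * y)\<^sup>2 / 2 \<le> 1 / 2"
  proof -
    have "(real k * y)\<^sup>2 \<le> (real k * (\<epsilon> / n))\<^sup>2"
      using y by (intro power_mono mult_left_mono) auto
    also have "\<dots> = (real k * \<epsilon>)\<^sup>2 / (real n)\<^sup>2"
      by (simp add: power_divide)
    also have "\<dots> \<le> real n / (real n)\<^sup>2"
      using \<open>(real k * \<epsilon>)\<^sup>2 \<le> real n\<close> by (rule divide_right_mono) simp
    finally show ?thesis
      using assms(1) by (simp add: power2_eq_square field_simps)
  qed
  finally show False
    using exp_half_less by simp
qed

theorem theorem18:
  shows "\<exists>c::real. c > 0 \<and>
    (\<forall>(n::nat) (\<epsilon>::real) (k::nat) (T :: (nat \<Rightarrow> real) list \<Rightarrow> bool pmf).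
       n \<ge> 1 \<longrightarrow> \<epsilon> > 0 \<longrightarrow> distinguishes_uniform n \<epsilon> k T \<longrightarrow>
       real k \<ge> c * sqrt (real n) / \<epsilon>)"
  using distinguishes_uniform_sample_bound
  by (intro exI[of _ 1]) (auto simp: divide_le_eq)

end
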